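(* Let $p\geq 23$ be a prime. There exists a covering system of the integers such that all moduli are odd, greater than $1$, and pairwise distinct, except that $p$ is used exactly $p-5$ times as a modulus.
   Context: A covering system of the integers is a finite collection of congruences $x\equiv r_j \pmod{m_j}$ such that every integer satisfies at least one of them. "$p$ is used exactly $p-5$ times as a modulus" means exactly $p-5$ congruences of the system have modulus $p$, while all other moduli are distinct from each other and from $p$. *)

theory Defs
  imports "HOL-Number_Theory.Number_Theory"
begin

text \<open>
  A pair \<open>(r, m)\<close> stands for the congruence \<open>x \<equiv> r (mod m)\<close>. The residue is normalized to
  \<open>0 \<le> r < m\<close>, so that distinct pairs are distinct congruences and cardinalities of sets of
  pairs count congruences.
\<close>

definition covering_system :: "(nat \<times> nat) set \<Rightarrow> bool" where
  "covering_system C \<longleftrightarrow>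
     finite C \<and>
     (\<forall>(r, m) \<in> C. r < m) \<and>
     (\<forall>x :: int. \<exists>(r, m) \<in> C. [x = int r] (mod int m))"

end

theory Submission
  imports Defs
begin

text \<open>
  For a prime \<open>q\<close> and an integer \<open>x\<close> with \<open>q ^ B\<close> not dividing \<open>x\<close>, the lowest nonzero base \<open>q\<close> digit
  \<open>e\<close> of \<open>x\<close>, at position \<open>k < B\<close>, gives \<open>x \<equiv> e q ^ k (mod q ^ (k + 1))\<close>. Given a finite set \<open>S\<close> of
  primes and one digit for each \<open>q \<in> S\<close>, all moduli with exactly the prime factors \<open>S\<close> together
  cover the integers whose lowest nonzero digits agree on \<open>S\<close>. The remaining \<open>x \<equiv> 0 (mod q ^ Q)\<close>
  are covered by the moduli \<open>q ^ b Q\<close> with \<open>1 \<le> b \<le> Q\<close> for one spare prime \<open>Q\<close>: on the class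
  \<open>0 (mod q ^ b)\<close> take the residue \<open>b\<close> modulo \<open>Q\<close>.

  It remains to cover the finite box of digit vectors for the primes \<open>p, 3, 5, 7, 11, 13, 17, 19\<close>
  by subcubes with pairwise distinct supports, other than the supports \<open>{}\<close> and \<open>{p}\<close>. The
  modulus \<open>p\<close> itself takes care of all classes modulo \<open>p\<close> but \<open>1, \<dots>, 5\<close>, so that the box has
  sides \<open>5, 2, 4, 6, 10, 12, 16, 18\<close>; a solution with 199 subcubes was found by computer search.
\<close>

section \<open>Congruences modulo prime powers and lowest nonzero digits\<close>

lemma prod_dvd_of_pairwise_coprime:
  fixes f :: "'b \<Rightarrow> 'a :: semiring_gcd"
  assumes "finite A" "\<And>i j. i \<in> A \<Longrightarrow> j \<in> A \<Longrightarrow> i \<noteq> j \<Longrightarrow> coprime (f i) (f j)"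
    and "\<And>i. i \<in> A \<Longrightarrow> f i dvd c"
  shows "prod f A dvd c"
  using assms
proof (induction A rule: finite_induct)
  case (insert a A)
  have "coprime (f a) (prod f A)"
    using insert by (intro prod_coprime_right) auto
  then show ?case
    using insert by (auto intro!: divides_mult)
qed simp

lemma cong_of_cong_prime_powers:
  fixes x y :: int and m :: nat
  assumes "m > 0"
    and "\<And>q. q \<in> prime_factors m \<Longrightarrow> [x = y] (mod int (q ^ multiplicity q m))"
  shows "[x = y] (mod int m)"
proof -
  have "(\<Prod>q\<in>prime_factors m. int (q ^ multiplicity q m)) dvd x - y"
    using assms(2)
    by (intro prod_dvd_of_pairwise_coprime)
       (auto simp: cong_iff_dvd_diff in_prime_factors_imp_prime primes_coprime simp flip: of_nat_power)
  also have "(\<Prod>q\<in>prime_factors m. int (q ^ multiplicity q m)) = int m"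
    using prime_factorization_nat[OF assms(1)] by (metis of_nat_prod)
  finally show ?thesis
    by (simp add: cong_iff_dvd_diff)
qed

lemma ex_residue_of_prime_powers:
  fixes m :: nat
  assumes "m > 0"
  shows "\<exists>r<m. \<forall>q\<in>prime_factors m. [r = u q] (mod q ^ multiplicity q m)"
proof -
  obtain r where r: "\<forall>q\<in>prime_factors m. [r = u q] (mod q ^ multiplicity q m)"
    using chinese_remainder_nat[of "prime_factors m" "\<lambda>q. q ^ multiplicity q m" u]
    by (auto simp: in_prime_factors_imp_prime primes_coprime)
  have "[r mod m = u q] (mod q ^ multiplicity q m)" if "q \<in> prime_factors m" for q
  proof -
    have "[r mod m = r] (mod q ^ multiplicity q m)"
      by (simp add: cong_def mod_mod_cancel multiplicity_dvd)
    then show ?thesis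
      using r that cong_trans by blast
  qed
  then show ?thesis
    using assms by (intro exI[of _ "r mod m"]) auto
qed

text \<open>Split off the full power of \<open>q\<close> from \<open>x\<close> and reduce the
  cofactor modulo \<open>q\<close>. The last conclusion serves the prime \<open>p\<close>: it
  identifies the digit at \<open>p\<close> with the residue of \<open>x\<close> modulo
  \<open>p\<close>.\<close>

lemma lowest_digit:
  fixes x :: int
  assumes "prime q" "\<not> int q ^ B dvd x"
  obtains k e where "k < B" "e \<in> {1..<q}" "[x = int (e * q ^ k)] (mod int q ^ Suc k)"
    "\<not> int q dvd x \<Longrightarrow> k = 0"
proof -
  define k where "k = multiplicity (int q) x"
  have "x \<noteq> 0"
    using assms by auto
  have prime: "prime (int q)"
    using assms(1) by simp
  have "\<not> is_unit (int q)"
    using prime not_prime_unit by blast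
  obtain y where y: "x = int q ^ k * y" "\<not> int q dvd y"
    using multiplicity_decompose'[OF \<open>x \<noteq> 0\<close> \<open>\<not> is_unit (int q)\<close>] unfolding k_def by blast
  have q0: "int q > 0"
    using prime prime_gt_0_int by blast
  define e where "e = nat (y mod int q)"
  have e: "int e = y mod int q"
    using q0 by (simp add: e_def)
  have "y mod int q \<noteq> 0" "y mod int q \<ge> 0" "y mod int q < int q"
    using y(2) q0 by auto
  then have "e \<in> {1..<q}"
    using e by auto
  moreover have "k < B"
    using assms(2) y(1) by (metis dvd_triv_left le_imp_power_dvd dvd_trans not_less)
  moreover have "[x = int (e * q ^ k)] (mod int q ^ Suc k)"
  proof -
    have "[y = int e] (mod int q)"
      by (simp add: e cong_def)
    then have "int q ^ k * int q dvd int q ^ k * (y - int e)"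
      by (simp add: cong_iff_dvd_diff)
    then show ?thesis
      by (simp add: cong_iff_dvd_diff y(1) algebra_simps)
  qed
  moreover have "k = 0" if "\<not> int q dvd x"
    using that by (simp add: k_def not_dvd_imp_multiplicity_0)
  ultimately show ?thesis
    using that by blast
qed

section \<open>From subcubes of digit vectors to a covering system\<close>

text \<open>\<open>A\<close> holds the classes modulo \<open>p\<close> that are not covered by
  \<open>p\<close> itself, so digit vectors matter only if \<open>e p\<close> lies in
  \<open>A\<close>. The digits \<open>D S\<close> are the subcube with support \<open>S\<close>;
  \<open>S \<noteq> {p}\<close> keeps the resulting modulus different from \<open>p\<close>.\<close>

lemma covering_system_of_digits:
  fixes P A :: "nat set" and p Q :: nat and D :: "nat set \<Rightarrow> nat \<Rightarrow> nat"
  assumes "finite P" and P: "\<And>q. q \<in> P \<Longrightarrow> prime q \<and> odd q" and "p \<in> P"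
    and Q: "prime Q" "odd Q" "Q \<notin> P"
    and A: "A \<subseteq> {1..<p}"
    and digits: "\<And>e. e p \<in> A \<Longrightarrow> (\<forall>q\<in>P. e q \<in> {1..<q}) \<Longrightarrow>
      \<exists>S\<subseteq>P. S \<noteq> {} \<and> S \<noteq> {p} \<and> (\<forall>q\<in>S. D S q = e q)"
  shows "\<exists>C. covering_system C \<and>
             (\<forall>(r, m) \<in> C. odd m \<and> m > 1) \<and>
             inj_on snd {c \<in> C. snd c \<noteq> p} \<and>
             card {c \<in> C. snd c = p} = p - card A"
proof -
  \<comment> \<open>The residue prescribed for \<open>m\<close> modulo its \<open>q\<close>-part.
    For \<open>m = q ^ b * Q\<close>, the sum of multiplicities recovers \<open>b\<close> without
    naming \<open>q\<close>; otherwise \<open>multiplicity q m - 1\<close> is the position of the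
    digit.\<close>
  define u where "u m q =
    (if Q dvd m then if q = Q then \<Sum>l\<in>P. multiplicity l m else 0
     else D (prime_factors m) q * q ^ (multiplicity q m - 1))" for m q
  have "\<forall>m. \<exists>r. m > 0 \<longrightarrow> r < m \<and> (\<forall>q\<in>prime_factors m. [r = u m q] (mod q ^ multiplicity q m))"
    using ex_residue_of_prime_powers by blast
  then obtain r where r: "\<And>m. m > 0 \<Longrightarrow> r m < m"
    "\<And>m q. m > 0 \<Longrightarrow> q \<in> prime_factors m \<Longrightarrow> [r m = u m q] (mod q ^ multiplicity q m)"
    by metis
  \<comment> \<open>The exponent \<open>Q\<close> leaves room both for \<open>b \<le> Q\<close> and
    for \<open>Suc k\<close> with a digit position \<open>k < Q\<close>.\<close>
  define N where "N = Q * (\<Prod>q\<in>P. q ^ Q)"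
  define M where "M = {m. m dvd N \<and> m > 1 \<and> m \<noteq> p}"
  define C where "C = (\<lambda>m. (r m, m)) ` M \<union> (\<lambda>i. (i, p)) ` ({..<p} - A)"
  have p: "prime p" "odd p" "p > 1"
    using P[OF \<open>p \<in> P\<close>] prime_gt_1_nat by auto
  have "N > 0"
    using P Q by (auto simp: N_def prime_gt_0_nat intro!: prod_pos)
  have "odd N"
    using P Q \<open>finite P\<close> by (auto simp: N_def even_prod_iff)
  have "finite M"
    using \<open>N > 0\<close> by (auto simp: M_def intro: finite_subset[OF _ finite_divisors_nat[of N]])
  have odd_M: "odd m" if "m \<in> M" for m
    using that \<open>odd N\<close> dvd_trans unfolding M_def by blast

  have "\<exists>(r, m)\<in>C. [x = int r] (mod int m)" for x :: int
  proof -
    \<comment> \<open>Reduces covering \<open>x\<close> to naming one modulus in \<open>M\<close>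
      and checking \<open>x\<close> against its prescribed residues.\<close>
    have by_M: ?thesis
      if "m \<in> M" "\<And>q. q \<in> prime_factors m \<Longrightarrow> [x = int (u m q)] (mod int (q ^ multiplicity q m))"
      for m
    proof -
      have "m > 0"
        using that(1) by (simp add: M_def)
      have "[x = int (r m)] (mod int m)"
      proof (rule cong_of_cong_prime_powers[OF \<open>m > 0\<close>])
        fix q assume q: "q \<in> prime_factors m"
        have "[int (r m) = int (u m q)] (mod int (q ^ multiplicity q m))"
          using r(2)[OF \<open>m > 0\<close> q] by (simp only: cong_int_iff)
        then show "[x = int (r m)] (mod int (q ^ multiplicity q m))"
          using that(2)[OF q] cong_sym cong_trans by blast
      qed
      then show ?thesis
        using \<open>m \<in> M\<close> by (auto simp: C_def)
    qed
    define i where "i = nat (x mod int p)"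
    have i: "i < p" "[x = int i] (mod int p)"
      using p by (auto simp: i_def cong_def nat_less_iff)
    show ?thesis
    proof (cases "i \<in> A")
      case False
      then show ?thesis
        using i by (auto simp: C_def)
    next
      case True
      show ?thesis
      proof (cases "\<exists>q\<in>P. int q ^ Q dvd x")
        case True
        then obtain q where q: "q \<in> P" "int q ^ Q dvd x"
          by blast
        have "prime q" "q \<noteq> Q"
          using P q Q by auto
        have "Q > 0"
          using Q prime_gt_0_nat by blast
        define c where "c = nat (x mod int Q)"
        have c: "int c = x mod int Q" "c < Q"
          using \<open>Q > 0\<close> by (auto simp: c_def nat_less_iff)
        \<comment> \<open>The class 0 modulo \<open>Q\<close> is represented by \<open>Q\<close>,
          since the exponent of \<open>q\<close> must be positive.\<close>
        define b where "b = (if c = 0 then Q else c)"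
        have "[int b = int c] (mod int Q)"
          by (simp add: b_def cong_def)
        then have b: "b \<le> Q" "b > 0" "[x = int b] (mod int Q)"
          using c \<open>Q > 0\<close> by (auto simp: b_def cong_def split: if_splits)
        define m where "m = q ^ b * Q"
        have mult_q: "multiplicity q m = b"
          using \<open>prime q\<close> \<open>prime Q\<close> \<open>q \<noteq> Q\<close>
          by (simp add: m_def prime_elem_multiplicity_mult_distrib prime_multiplicity_other)
        have mult_Q: "multiplicity Q m = 1"
          using \<open>prime q\<close> \<open>prime Q\<close> \<open>q \<noteq> Q\<close>
          by (simp add: m_def prime_elem_multiplicity_mult_distrib multiplicity_distinct_prime_power)
        have mult_l: "multiplicity l m = (if l = q then b else 0)" if "l \<in> P" for l
        proof -
          have "prime l" "l \<noteq> Q"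
            using P Q that by auto
          then show ?thesis
            using \<open>prime q\<close> \<open>prime Q\<close> mult_q
            by (auto simp: m_def prime_elem_multiplicity_mult_distrib prime_multiplicity_other
                multiplicity_distinct_prime_power)
        qed
        have factors: "prime_factors m = {q, Q}"
          using \<open>prime q\<close> \<open>prime Q\<close> b
          by (auto simp: m_def prime_factorization_mult prime_factorization_prime_power
              prime_factorization_prime prime_gt_0_nat)
        have "m dvd N"
        proof -
          have "q ^ b dvd q ^ Q"
            using b by (simp add: le_imp_power_dvd)
          also have "q ^ Q dvd (\<Prod>q\<in>P. q ^ Q)"
            using q \<open>finite P\<close> by (intro dvd_prodI) auto
          finally show ?thesis
            by (simp add: m_def N_def mult.commute)
        qed
        moreover have "m \<noteq> p"
        proof
          assume "m = p"
          then have "prime_factors m = {p}"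
            using p by (simp add: prime_factorization_prime)
          then show False
            using factors \<open>q \<noteq> Q\<close> by auto
        qed
        moreover have "m > 1"
          using factors by (cases "m = 0 \<or> m = 1") auto
        ultimately have "m \<in> M"
          by (simp add: M_def)
        then show ?thesis
        proof (rule by_M)
          fix l assume "l \<in> prime_factors m"
          then consider "l = q" | "l = Q"
            using factors by auto
          then show "[x = int (u m l)] (mod int (l ^ multiplicity l m))"
          proof cases
            case 1
            have "int q ^ b dvd x"
              using q b by (meson dvd_trans le_imp_power_dvd)
            then show ?thesis
              using 1 \<open>q \<noteq> Q\<close> mult_q by (simp add: u_def m_def cong_0_iff)
          next
            case 2
            have "(\<Sum>l\<in>P. multiplicity l m) = b"
              using mult_l q \<open>finite P\<close> by (simp add: sum.delta)
            then show ?thesis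
              using 2 b mult_Q by (simp add: u_def m_def)
          qed
        qed
      next
        case False
        then have "\<forall>q\<in>P. \<exists>k e. k < Q \<and> e \<in> {1..<q} \<and>
            [x = int (e * q ^ k)] (mod int q ^ Suc k) \<and> (\<not> int q dvd x \<longrightarrow> k = 0)"
          using P by (metis lowest_digit)
        then obtain k e where ke: "\<And>q. q \<in> P \<Longrightarrow> k q < Q \<and> e q \<in> {1..<q} \<and>
            [x = int (e q * q ^ k q)] (mod int q ^ Suc (k q)) \<and> (\<not> int q dvd x \<longrightarrow> k q = 0)"
          by metis
        \<comment> \<open>As 0 is not in \<open>A\<close>, the digit of \<open>x\<close> at
          \<open>p\<close> sits at position 0 and equals \<open>i\<close>, so \<open>digits\<close>
          applies.\<close>
        have "\<not> int p dvd x"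
        proof
          assume "int p dvd x"
          then have "i = 0"
            by (simp add: i_def)
          then show False
            using \<open>i \<in> A\<close> A by auto
        qed
        then have "[x = int (e p)] (mod int p)" "e p < p"
          using ke[OF \<open>p \<in> P\<close>] by auto
        then have "e p = i"
          using i by (metis cong_int_iff cong_less_modulus_unique_nat cong_sym cong_trans)
        then obtain S where S: "S \<subseteq> P" "S \<noteq> {}" "S \<noteq> {p}" "\<forall>q\<in>S. D S q = e q"
          using digits[of e] ke \<open>i \<in> A\<close> by blast
        \<comment> \<open>The positions \<open>k\<close> enter only through the exponents; the
          support stays \<open>S\<close>, so the residue of \<open>m\<close> uses the same digits
          \<open>D S\<close> for all positions.\<close>
        define m where "m = (\<Prod>q\<in>S. q ^ Suc (k q))"
        have "finite S"
          using S \<open>finite P\<close> finite_subset by blast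
        have mult: "multiplicity q m = (if q \<in> S then Suc (k q) else 0)" if "prime q" for q
          unfolding m_def using that S P \<open>finite S\<close>
          by (intro multiplicity_prod_prime_powers) auto
        have factors: "prime_factors m = S"
          using mult S P by (auto simp: prime_factors_multiplicity split: if_splits)
        have "\<not> Q dvd m"
          using factors Q S by (metis in_prime_factors_iff empty_iff set_mset_empty
              prime_factorization_0 subsetD)
        have "m dvd N"
        proof -
          have "m dvd (\<Prod>q\<in>S. q ^ Q)"
            unfolding m_def using ke S by (intro prod_dvd_prod le_imp_power_dvd) (auto simp: Suc_le_eq)
          also have "\<dots> dvd (\<Prod>q\<in>P. q ^ Q)"
            using S \<open>finite P\<close> by (intro prod_dvd_prod_subset) auto
          finally show ?thesis
            by (simp add: N_def)
        qed
        moreover have "m \<noteq> p"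
          using factors S p by (auto simp: prime_factorization_prime)
        moreover have "m > 1"
          using factors S by (cases "m = 0 \<or> m = 1") auto
        ultimately have "m \<in> M"
          by (simp add: M_def)
        then show ?thesis
        proof (rule by_M)
          fix q assume "q \<in> prime_factors m"
          then have "q \<in> S" "prime q"
            using factors by auto
          then show "[x = int (u m q)] (mod int (q ^ multiplicity q m))"
            using ke[of q] S \<open>\<not> Q dvd m\<close> factors mult by (auto simp: u_def)
        qed
      qed
    qed
  qed
  moreover have "finite C" "\<forall>(r, m)\<in>C. r < m" "\<forall>(r, m)\<in>C. odd m \<and> m > 1"
    using \<open>finite M\<close> odd_M p r(1) by (auto simp: C_def M_def)
  moreover have "inj_on snd {c \<in> C. snd c \<noteq> p}"
    by (auto simp: C_def inj_on_def)
  moreover have "card {c \<in> C. snd c = p} = p - card A"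
  proof -
    have "{c \<in> C. snd c = p} = (\<lambda>i. (i, p)) ` ({..<p} - A)"
      by (auto simp: C_def M_def)
    then have "card {c \<in> C. snd c = p} = card ({..<p} - A)"
      by (simp add: card_image inj_on_def)
    also have "\<dots> = p - card A"
      using A by (subst card_Diff_subset) (auto intro: finite_subset)
    finally show ?thesis .
  qed
  ultimately show ?thesis
    unfolding covering_system_def by blast
qed

section \<open>A checker for coverings of a box by subcubes\<close>

text \<open>
  A row lists the digits of a subcube; entry \<open>0\<close> means that the coordinate is free, and trailing
  free coordinates are omitted.
\<close>

fun restrict_rows :: "nat \<Rightarrow> nat list list \<Rightarrow> nat list list" where
  "restrict_rows d ((x # r) # rs) =
     (if x = 0 \<or> x = d then r # restrict_rows d rs else restrict_rows d rs)"
| "restrict_rows d ([] # rs) = [] # restrict_rows d rs"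
| "restrict_rows d [] = []"

text \<open>
  The row without constraints is only looked for at the head of the list, which loses nothing if
  the rows are sorted by length. Matching on it, instead of forming a disjunction, lets the
  simplifier stop there.
\<close>

fun covers_box :: "nat list \<Rightarrow> nat list list \<Rightarrow> bool" where
  "covers_box ns ([] # rs) \<longleftrightarrow> True"
| "covers_box (n # ns) rs \<longleftrightarrow> (\<forall>d\<in>set [1..<Suc n]. covers_box ns (restrict_rows d rs))"
| "covers_box [] rs \<longleftrightarrow> False"

definition matches :: "nat list \<Rightarrow> nat list \<Rightarrow> bool" where
  "matches r es \<longleftrightarrow> (\<forall>(x, e)\<in>set (zip r es). x = 0 \<or> x = e)"

lemma matches_simps [simp]:
  "matches [] es" "matches (x # r) (e # es) \<longleftrightarrow> (x = 0 \<or> x = e) \<and> matches r es"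
  by (auto simp: matches_def)

text \<open>The length bound is carried along because \<open>matches\<close> compares only up to the
  end of the shorter list, so an overlong row could match with digits left unchecked. It is an
  inequality because the empty row restricts to itself.\<close>

lemma restrict_rows_sound:
  assumes "r \<in> set (restrict_rows d rs)" "matches r es"
  shows "\<exists>r'\<in>set rs. length r' \<le> Suc (length r) \<and> matches r' (d # es)"
  using assms(1)
proof (induction d rs rule: restrict_rows.induct)
  case (1 d x r' rs)
  then show ?case
    using assms(2) by (auto split: if_splits intro: bexI[of _ "x # r"])
qed auto

lemma covers_box_sound:
  assumes "covers_box ns rs" "list_all2 (\<lambda>e n. e \<in> {1..n}) es ns"
  shows "\<exists>r\<in>set rs. length r \<le> length es \<and> matches r es"
  using assms
proof (induction ns arbitrary: rs es)
  case Nil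
  then show ?case
    \<comment> \<open>Only the shape of \<open>rs\<close> matters; the 0 is a dummy digit.\<close>
    by (cases "(0::nat, rs)" rule: restrict_rows.cases) auto
next
  case (Cons n ns)
  obtain e es' where es: "es = e # es'" "e \<in> {1..n}" "list_all2 (\<lambda>e n. e \<in> {1..n}) es' ns"
    using Cons.prems(2) by (auto simp: list_all2_Cons2)
  show ?case
  proof (cases "\<exists>rs'. rs = [] # rs'")
    case True
    then show ?thesis
      by auto
  next
    case False
    then have "\<forall>d\<in>set [1..<Suc n]. covers_box ns (restrict_rows d rs)"
      using Cons.prems(1) by (cases "(0::nat, rs)" rule: restrict_rows.cases) auto
    moreover have "e \<in> set [1..<Suc n]"
      using es(2) by auto
    ultimately have "covers_box ns (restrict_rows e rs)"
      by blast
    then obtain r where r: "r \<in> set (restrict_rows e rs)" "length r \<le> length es'" "matches r es'"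
      using Cons.IH es(3) by blast
    then obtain r' where "r' \<in> set rs" "length r' \<le> Suc (length r)" "matches r' (e # es')"
      using restrict_rows_sound by blast
    then show ?thesis
      using r(2) es(1) by (intro bexI[of _ r']) auto
  qed
qed

section \<open>Supports of rows and distinctness of moduli\<close>

definition nonzero_positions :: "nat list \<Rightarrow> nat set" where
  "nonzero_positions r = {j. j < length r \<and> r ! j \<noteq> 0}"

text \<open>
  Listing the rows by increasing code reduces the distinctness of the supports to comparing
  neighbours.
\<close>

definition support_code :: "nat list \<Rightarrow> nat" where
  "support_code r = horner_sum (\<lambda>x. of_bool (x \<noteq> 0)) 2 r"

lemma support_code_eq_sum: "support_code r = (\<Sum>j\<in>nonzero_positions r. 2 ^ j)"
proof -
  have "support_code r = (\<Sum>j<length r. if r ! j \<noteq> 0 then 2 ^ j else 0)"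
    unfolding support_code_def horner_sum_eq_sum atLeast0LessThan by (rule sum.cong) auto
  also have "\<dots> = (\<Sum>j\<in>nonzero_positions r. 2 ^ j)"
    by (subst sum.inter_filter[symmetric]) (auto simp: nonzero_positions_def)
  finally show ?thesis .
qed

text \<open>The code depends only on the set of nonzero positions, and distinct positions name
  distinct primes of \<open>ps\<close>. Equal supports thus give equal codes, hence equal
  rows.\<close>

lemma inj_on_support:
  assumes "distinct ps" "\<forall>r\<in>set rs. length r \<le> length ps" "distinct (map support_code rs)"
  shows "inj_on (\<lambda>r. (!) ps ` nonzero_positions r) (set rs)"
proof (rule inj_onI)
  fix r s
  assume rs: "r \<in> set rs" "s \<in> set rs"
    and eq: "(!) ps ` nonzero_positions r = (!) ps ` nonzero_positions s"
  have "inj_on ((!) ps) {..<length ps}"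
    using assms(1) by (intro inj_on_nth) auto
  moreover have "nonzero_positions t \<subseteq> {..<length ps}" if "t \<in> set rs" for t
    using assms(2) that by (fastforce simp: nonzero_positions_def)
  ultimately have "nonzero_positions r = nonzero_positions s"
    using eq rs by (meson inj_on_image_eq_iff)
  then have "support_code r = support_code s"
    by (simp add: support_code_eq_sum)
  then show "r = s"
    using assms(3) rs by (auto simp: distinct_map inj_on_def)
qed

text \<open>The head of \<open>ps\<close> is the repeated prime, with \<open>A = {1..n}\<close>; for
  every other prime the side must admit all nonzero digits. A nonzero entry in \<open>tl r\<close>
  rules out the supports \<open>{}\<close> and \<open>{hd ps}\<close>.\<close>

lemma covering_system_of_rows:
  assumes "distinct ps" and ps: "\<And>q. q \<in> set ps \<Longrightarrow> prime q \<and> odd q"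
    and "ps \<noteq> []"
    and Q: "prime Q" "odd Q" "Q \<notin> set ps"
    and ns: "covers_box (n # ns) rs" "n < hd ps" "list_all2 (\<lambda>q n. q \<le> Suc n) (tl ps) ns"
    and rs: "\<forall>r\<in>set rs. length r \<le> length ps" "distinct (map support_code rs)"
      "\<forall>r\<in>set rs. \<exists>x\<in>set (tl r). x \<noteq> 0"
  shows "\<exists>C. covering_system C \<and>
             (\<forall>(r, m) \<in> C. odd m \<and> m > 1) \<and>
             inj_on snd {c \<in> C. snd c \<noteq> hd ps} \<and>
             card {c \<in> C. snd c = hd ps} = hd ps - n"
proof -
  obtain p qs where ps_eq: "ps = p # qs"
    using \<open>ps \<noteq> []\<close> by (cases ps) auto
  have len: "length qs = length ns"
    using list_all2_lengthD[OF ns(3)] by (simp add: ps_eq)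
  define supp where "supp r = (!) ps ` nonzero_positions r" for r
  have inj: "inj_on supp (set rs)"
    using inj_on_support[OF assms(1) rs(1,2)] by (simp add: supp_def[abs_def])
  \<comment> \<open>By injectivity of \<open>supp\<close>, a support determines its row, in which
    the digit at \<open>q\<close> is looked up; for other sets the value is irrelevant.\<close>
  define D where "D S q = the (map_of (zip ps (inv_into (set rs) supp S)) q)" for S q
  have D: "D (supp r) (ps ! j) = r ! j" if "r \<in> set rs" "j < length r" for r j
  proof -
    have "(ps ! j, r ! j) \<in> set (zip ps r)"
      using that rs(1) by (auto simp: set_zip intro!: exI[of _ j])
    then have "map_of (zip ps r) (ps ! j) = Some (r ! j)"
      using assms(1) by (intro map_of_is_SomeI) (simp_all add: map_fst_zip_take)
    then show ?thesis
      using that(1) inj by (simp add: D_def)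
  qed
  have "\<exists>S\<subseteq>set ps. S \<noteq> {} \<and> S \<noteq> {p} \<and> (\<forall>q\<in>S. D S q = e q)"
    if e: "e p \<in> {1..n}" "\<forall>q\<in>set ps. e q \<in> {1..<q}" for e
  proof -
    have "list_all2 (\<lambda>e n. e \<in> {1..n}) (map e qs) ns"
    proof (rule list_all2_all_nthI)
      fix j assume j: "j < length (map e qs)"
      then have "e (qs ! j) \<in> {1..<qs ! j}"
        using e(2) by (auto simp: ps_eq)
      moreover have "qs ! j \<le> Suc (ns ! j)"
        using ns(3) j by (auto simp: ps_eq list_all2_conv_all_nth)
      ultimately show "map e qs ! j \<in> {1..ns ! j}"
        using j by auto
    qed (simp add: len)
    then have "list_all2 (\<lambda>e n. e \<in> {1..n}) (map e ps) (n # ns)"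
      using e(1) by (simp add: ps_eq)
    then obtain r where r: "r \<in> set rs" "length r \<le> length ps" "matches r (map e ps)"
      using covers_box_sound[OF ns(1)] by fastforce
    have "supp r \<subseteq> set ps"
      using r(2) by (auto simp: supp_def nonzero_positions_def)
    moreover have "\<forall>q\<in>supp r. D (supp r) q = e q"
    proof
      fix q assume "q \<in> supp r"
      then obtain j where j: "q = ps ! j" "j < length r" "r ! j \<noteq> 0"
        by (auto simp: supp_def nonzero_positions_def)
      then have "r ! j = e q"
        using r(2,3) by (fastforce simp: matches_def set_zip)
      then show "D (supp r) q = e q"
        using D[OF r(1)] j by simp
    qed
    moreover have "supp r \<noteq> {}" "supp r \<noteq> {p}"
    proof -
      obtain x where "x \<in> set (tl r)" "x \<noteq> 0"
        using rs(3) r(1) by blast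
      then obtain j where j: "j < length (tl r)" "tl r ! j \<noteq> 0"
        by (metis in_set_conv_nth)
      then have "Suc j \<in> nonzero_positions r"
        by (auto simp: nonzero_positions_def nth_tl)
      then have "qs ! j \<in> supp r"
        by (force simp: supp_def ps_eq)
      moreover have "qs ! j \<noteq> p"
        using assms(1) nth_mem[of j qs] j r(2) by (auto simp: ps_eq)
      ultimately show "supp r \<noteq> {}" "supp r \<noteq> {p}"
        by auto
    qed
    ultimately show ?thesis
      by blast
  qed
  then have "\<exists>C. covering_system C \<and> (\<forall>(r, m) \<in> C. odd m \<and> m > 1) \<and>
      inj_on snd {c \<in> C. snd c \<noteq> p} \<and> card {c \<in> C. snd c = p} = p - card {1..n}"
    using ns(2) ps Q by (intro covering_system_of_digits[of "set ps" p Q _ D]) (auto simp: ps_eq)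
  then show ?thesis
    by (simp add: ps_eq)
qed

section \<open>The explicit subcubes and the conclusion\<close>

text \<open>The columns belong to \<open>p, 3, 5, 7, 11, 13, 17, 19\<close> in this order. Each row
  ends in a nonzero entry, so increasing support code also sorts by length, as suits
  \<open>covers_box\<close>.\<close>

definition rows :: "nat list list" where
  "rows = [
    [0, 1], [5, 2], [0, 0, 3], [2, 0, 1], [0, 2, 4], [3, 2, 1], [0, 0, 0, 5], [4, 0, 0, 3],
    [0, 2, 0, 6], [4, 2, 0, 4], [0, 0, 2, 1], [4, 0, 1, 1], [0, 2, 2, 2], [4, 2, 1, 2],
    [0, 0, 0, 0, 5], [1, 0, 0, 0, 10], [0, 2, 0, 0, 2], [1, 2, 0, 0, 8], [0, 0, 2, 0, 9],
    [3, 0, 2, 0, 10], [0, 2, 2, 0, 6], [2, 2, 2, 0, 10], [0, 0, 0, 3, 1], [3, 0, 0, 3, 8],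
    [0, 2, 0, 3, 3], [0, 0, 2, 3, 7], [3, 0, 2, 4, 8], [0, 2, 2, 3, 4], [0, 0, 0, 0, 0, 11],
    [1, 0, 0, 0, 0, 7], [0, 2, 0, 0, 0, 12], [1, 2, 0, 0, 0, 3], [0, 0, 2, 0, 0, 6],
    [1, 0, 1, 0, 0, 9], [0, 2, 2, 0, 0, 10], [1, 2, 1, 0, 0, 10], [0, 0, 0, 4, 0, 5],
    [2, 0, 0, 4, 0, 3], [0, 2, 0, 4, 0, 4], [2, 2, 0, 4, 0, 7], [0, 0, 2, 4, 0, 9],
    [3, 0, 2, 4, 0, 7], [0, 2, 2, 4, 0, 8], [3, 2, 2, 4, 0, 3], [0, 0, 0, 0, 7, 1],
    [2, 0, 0, 0, 8, 9], [0, 2, 0, 0, 3, 1], [2, 2, 0, 0, 8, 4], [0, 0, 2, 0, 3, 2],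
    [2, 0, 2, 0, 8, 1], [0, 2, 2, 0, 4, 2], [2, 2, 2, 0, 8, 2], [0, 0, 0, 4, 7, 2],
    [2, 0, 0, 3, 8, 5], [0, 2, 0, 4, 4, 1], [2, 2, 0, 3, 8, 7], [0, 0, 2, 4, 1, 1],
    [2, 0, 2, 3, 8, 8], [0, 2, 2, 4, 1, 2], [2, 2, 2, 3, 8, 3], [0, 0, 0, 0, 0, 0, 10],
    [1, 0, 0, 0, 0, 0, 7], [0, 2, 0, 0, 0, 0, 4], [1, 2, 0, 0, 0, 0, 14], [0, 0, 1, 0, 0, 0, 3],
    [1, 0, 1, 0, 0, 0, 15], [0, 2, 1, 0, 0, 0, 16], [1, 2, 1, 0, 0, 0, 5], [0, 0, 0, 2, 0, 0, 13],
    [1, 0, 0, 2, 0, 0, 11], [0, 2, 0, 1, 0, 0, 11], [1, 2, 0, 1, 0, 0, 1], [0, 0, 1, 1, 0, 0, 8],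
    [1, 0, 1, 1, 0, 0, 12], [0, 2, 1, 1, 0, 0, 13], [1, 2, 1, 1, 0, 0, 2], [0, 0, 0, 0, 6, 0, 9],
    [1, 0, 0, 0, 3, 0, 9], [0, 2, 0, 0, 7, 0, 9], [1, 2, 0, 0, 6, 0, 12], [1, 0, 1, 0, 9, 0, 9],
    [0, 2, 1, 0, 4, 0, 9], [1, 2, 1, 0, 1, 0, 9], [0, 0, 0, 3, 6, 0, 11], [1, 0, 0, 3, 7, 0, 11],
    [1, 2, 0, 3, 4, 0, 11], [0, 0, 1, 3, 9, 0, 11], [0, 0, 0, 0, 0, 1, 6], [1, 0, 0, 0, 0, 8, 6],
    [0, 2, 0, 0, 0, 5, 6], [1, 2, 0, 0, 0, 6, 8], [0, 0, 1, 0, 0, 2, 6], [1, 0, 1, 0, 0, 6, 1],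
    [0, 2, 1, 0, 0, 4, 6], [1, 2, 1, 0, 0, 6, 6], [0, 0, 0, 4, 0, 2, 11], [1, 0, 0, 4, 0, 1, 11],
    [0, 2, 0, 4, 0, 6, 11], [1, 2, 0, 2, 0, 2, 8], [0, 0, 1, 2, 0, 4, 1], [1, 0, 1, 2, 0, 6, 12],
    [0, 2, 1, 4, 0, 8, 11], [1, 2, 1, 2, 0, 8, 1], [0, 0, 0, 0, 6, 1, 8], [1, 2, 1, 0, 6, 1, 1],
    [0, 0, 0, 0, 0, 0, 0, 7], [1, 0, 0, 0, 0, 0, 0, 11], [0, 2, 0, 0, 0, 0, 0, 6],
    [1, 2, 0, 0, 0, 0, 0, 3], [0, 0, 1, 0, 0, 0, 0, 8], [1, 0, 1, 0, 0, 0, 0, 13],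
    [0, 2, 1, 0, 0, 0, 0, 4], [1, 2, 1, 0, 0, 0, 0, 1], [0, 0, 0, 3, 0, 0, 0, 9],
    [1, 0, 0, 3, 0, 0, 0, 14], [0, 2, 0, 2, 0, 0, 0, 15], [1, 2, 0, 4, 0, 0, 0, 10],
    [0, 0, 1, 3, 0, 0, 0, 10], [1, 0, 1, 4, 0, 0, 0, 15], [0, 2, 1, 2, 0, 0, 0, 9],
    [1, 2, 1, 3, 0, 0, 0, 15], [0, 0, 0, 0, 4, 0, 0, 16], [1, 0, 0, 0, 9, 0, 0, 12],
    [0, 2, 0, 0, 6, 0, 0, 16], [1, 2, 0, 0, 4, 0, 0, 12], [0, 0, 1, 0, 7, 0, 0, 16],
    [1, 0, 1, 0, 9, 0, 0, 16], [0, 2, 1, 0, 7, 0, 0, 12], [1, 2, 1, 0, 6, 0, 0, 12],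
    [0, 0, 0, 4, 1, 0, 0, 12], [1, 0, 0, 2, 1, 0, 0, 12], [0, 2, 0, 2, 1, 0, 0, 16],
    [1, 2, 0, 4, 3, 0, 0, 12], [0, 0, 1, 4, 1, 0, 0, 16], [1, 0, 1, 2, 3, 0, 0, 12],
    [0, 2, 1, 4, 3, 0, 0, 16], [1, 2, 1, 2, 3, 0, 0, 16], [0, 0, 0, 0, 0, 5, 0, 5],
    [1, 0, 0, 0, 0, 5, 0, 17], [0, 2, 0, 0, 0, 8, 0, 5], [1, 2, 0, 0, 0, 2, 0, 5],
    [0, 0, 1, 0, 0, 8, 0, 14], [1, 0, 1, 0, 0, 8, 0, 17], [0, 2, 1, 0, 0, 2, 0, 17],
    [1, 2, 1, 0, 0, 4, 0, 17], [0, 0, 0, 4, 0, 2, 0, 9], [1, 0, 0, 3, 0, 4, 0, 5],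
    [0, 2, 0, 2, 0, 4, 0, 5], [1, 2, 0, 4, 0, 6, 0, 9], [0, 0, 1, 4, 0, 6, 0, 14],
    [1, 0, 1, 4, 0, 2, 0, 14], [0, 2, 1, 2, 0, 5, 0, 14], [1, 2, 1, 4, 0, 8, 0, 9],
    [0, 0, 0, 0, 9, 1, 0, 14], [1, 0, 0, 0, 4, 1, 0, 17], [0, 2, 0, 0, 1, 1, 0, 17],
    [1, 2, 0, 0, 9, 1, 0, 17], [0, 0, 1, 0, 1, 1, 0, 5], [1, 0, 1, 0, 1, 1, 0, 14],
    [0, 2, 1, 0, 9, 1, 0, 5], [1, 2, 1, 0, 4, 1, 0, 5], [0, 0, 0, 4, 9, 1, 0, 9],
    [0, 2, 0, 2, 4, 1, 0, 14], [1, 0, 1, 4, 6, 1, 0, 9], [0, 2, 1, 4, 6, 1, 0, 14],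
    [1, 2, 1, 4, 1, 1, 0, 9], [0, 0, 0, 0, 0, 0, 2, 2], [1, 0, 0, 0, 0, 0, 8, 2],
    [0, 2, 0, 0, 0, 0, 12, 18], [1, 2, 0, 0, 0, 0, 1, 2], [0, 0, 1, 0, 0, 0, 8, 18],
    [1, 0, 1, 0, 0, 0, 1, 18], [0, 2, 1, 0, 0, 0, 2, 18], [1, 2, 1, 0, 0, 0, 12, 2],
    [0, 0, 0, 2, 0, 0, 8, 10], [1, 0, 0, 4, 0, 0, 13, 2], [0, 2, 0, 4, 0, 0, 13, 18],
    [1, 2, 0, 2, 0, 0, 12, 10], [0, 0, 1, 3, 0, 0, 13, 18], [1, 0, 1, 3, 0, 0, 13, 2],
    [0, 2, 1, 2, 0, 0, 2, 10], [1, 2, 1, 2, 0, 0, 2, 14], [1, 0, 0, 0, 6, 0, 13, 5],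
    [1, 2, 0, 0, 6, 0, 2, 17], [1, 0, 1, 0, 6, 0, 13, 17], [0, 0, 0, 0, 0, 6, 12, 17],
    [1, 0, 0, 0, 0, 6, 13, 17], [0, 2, 0, 0, 0, 6, 13, 5], [1, 2, 0, 0, 0, 1, 1, 10],
    [0, 0, 1, 0, 0, 6, 2, 5], [1, 0, 1, 0, 0, 1, 2, 5], [0, 2, 1, 0, 0, 6, 12, 5],
    [1, 2, 1, 0, 0, 6, 2, 17], [0, 0, 0, 2, 0, 2, 12, 14], [1, 0, 0, 2, 0, 5, 1, 10],
    [1, 2, 0, 2, 0, 2, 1, 10], [0, 0, 1, 2, 0, 4, 12, 14], [1, 0, 1, 2, 0, 2, 1, 14],
    [1, 2, 1, 2, 0, 4, 8, 14]]"

lemma rows_support_code: "successively (<) (map support_code rows)"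
  by (simp add: rows_def support_code_def)

lemma rows_length: "\<forall>r\<in>set rows. length r \<le> 8 \<and> (\<exists>x\<in>set (tl r). x \<noteq> 0)"
  by (simp add: rows_def)

text \<open>The box has 8294400 points, but a branch ends as soon as some row has all its digits
  matched, which settles a whole subbox at once.\<close>

lemma rows_cover: "covers_box [5, 2, 4, 6, 10, 12, 16, 18] rows"
  by code_simp

theorem theorem4p3:
  fixes p :: nat
  assumes "prime p" and "p \<ge> 23"
  shows "\<exists>C. covering_system C \<and>
             (\<forall>(r, m) \<in> C. odd m \<and> m > 1) \<and>
             inj_on snd {c \<in> C. snd c \<noteq> p} \<and>
             card {c \<in> C. snd c = p} = p - 5"
proof -
  define ps where "ps = [p, 3, 5, 7, 11, 13, 17, 19]"
  \<comment> \<open>The spare prime must avoid \<open>ps\<close>: 23 exceeds the fixed primes, and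
    29 replaces it when \<open>p\<close> is 23.\<close>
  define Q :: nat where "Q = (if p = 23 then 29 else 23)"
  have "odd p"
    using assms prime_odd_nat by auto
  have "distinct (map support_code rows)"
    using rows_support_code by (simp add: successively_conv_sorted_wrt strict_sorted_iff)
  then have "\<exists>C. covering_system C \<and> (\<forall>(r, m) \<in> C. odd m \<and> m > 1) \<and>
      inj_on snd {c \<in> C. snd c \<noteq> hd ps} \<and> card {c \<in> C. snd c = hd ps} = hd ps - 5"
    using assms \<open>odd p\<close> rows_length rows_cover
    by (intro covering_system_of_rows[where Q = Q and rs = rows and ns = "[2, 4, 6, 10, 12, 16, 18]"])
       (auto simp: ps_def Q_def)
  then show ?thesis
    by (simp add: ps_def)
qed

end
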